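(* For any modal formula $A$, the following are equivalent: (1) $\mathbf{NR4}\vdash A$; (2) $A$ is valid in all transitive and serial $\mathbf{N}$-frames; (3) $A$ is valid in all finite transitive and serial $\mathbf{N}$-frames; (4) $A$ is valid in all finite $\mathrm{Sub}(A)$-transitive and $\mathrm{Sub}(A)$-serial $\mathbf{N}$-frames.
   Context: Modal formulas are built from propositional variables and $\bot$ using $\neg,\land,\lor,\to$ and $\Box$; $\mathrm{Sub}(A)$ is the set of subformulas of $A$. $\mathbf{N}$ has all propositional tautologies as axioms and Modus Ponens and Necessitation $A/\Box A$ as rules; $\mathbf{NR}$ is $\mathbf{N}$ plus the rule $\neg B/\neg\Box B$; $\mathbf{NR4}$ is $\mathbf{NR}$ plus the axiom scheme $\Box B\to\Box\Box B$. An $\mathbf{N}$-frame is $(W, \{\prec_B\}_B)$ with $W$ nonempty and a binary relation $\prec_B$ on $W$ for each modal formula $B$ (finite if $W$ is finite); an $\mathbf{N}$-model adds $\Vdash$ with usual propositional clauses and $x\Vdash\Box B$ iff $y\Vdash B$ for all $y$ with $x\prec_B y$. Validity in a frame means truth at all worlds of all models on the frame. The frame is $B$-serial if every $x$ has some $y$ with $x\prec_B y$; $\Gamma$-serial if $B$-serial for every $B$ with $\Box B\in\Gamma$; serial if $B$-serial for all $B$. It is $B$-transitive if $x\prec_{\Box B} y$ and $y\prec_B z$ imply $x\prec_B z$; $\Gamma$-transitive if $B$-transitive for every $B$ with $\Box\Box B\in\Gamma$; transitive if $B$-transitive for all $B$. *)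

theory Defs
  imports Main
begin

datatype 'p fm =
    Var 'p
  | Bot
  | Neg "'p fm"
  | And "'p fm" "'p fm"
  | Or "'p fm" "'p fm"
  | Imp "'p fm" "'p fm"
  | Box "'p fm"

primrec Sub :: "'p fm \<Rightarrow> 'p fm set" where
  "Sub (Var p) = {Var p}"
| "Sub Bot = {Bot}"
| "Sub (Neg A) = insert (Neg A) (Sub A)"
| "Sub (And A B) = insert (And A B) (Sub A \<union> Sub B)"
| "Sub (Or A B) = insert (Or A B) (Sub A \<union> Sub B)"
| "Sub (Imp A B) = insert (Imp A B) (Sub A \<union> Sub B)"
| "Sub (Box A) = insert (Box A) (Sub A)"

text \<open>Propositional tautologies in the modal language: propositional variables and boxed
  formulas are treated as atoms, which receive arbitrary truth values.\<close>

primrec prop_eval :: "('p fm \<Rightarrow> bool) \<Rightarrow> 'p fm \<Rightarrow> bool" where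
  "prop_eval v (Var p) \<longleftrightarrow> v (Var p)"
| "prop_eval v Bot \<longleftrightarrow> False"
| "prop_eval v (Neg A) \<longleftrightarrow> \<not> prop_eval v A"
| "prop_eval v (And A B) \<longleftrightarrow> prop_eval v A \<and> prop_eval v B"
| "prop_eval v (Or A B) \<longleftrightarrow> prop_eval v A \<or> prop_eval v B"
| "prop_eval v (Imp A B) \<longleftrightarrow> (prop_eval v A \<longrightarrow> prop_eval v B)"
| "prop_eval v (Box A) \<longleftrightarrow> v (Box A)"

definition tautology :: "'p fm \<Rightarrow> bool" where
  "tautology A \<longleftrightarrow> (\<forall>v. prop_eval v A)"

inductive NR4 :: "'p fm \<Rightarrow> bool" where
  Taut: "tautology A \<Longrightarrow> NR4 A"
| Four: "NR4 (Imp (Box B) (Box (Box B)))"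
| MP: "NR4 (Imp A B) \<Longrightarrow> NR4 A \<Longrightarrow> NR4 B"
| Nec: "NR4 A \<Longrightarrow> NR4 (Box A)"
| Ros: "NR4 (Neg B) \<Longrightarrow> NR4 (Neg (Box B))"

text \<open>A frame is given by its set \<open>W\<close> of worlds and the family \<open>R\<close> of relations on \<open>W\<close>,
  where \<open>(x, y) \<in> R B\<close> stands for \<open>x \<prec>\<^sub>B y\<close>.\<close>

definition N_frame :: "'w set \<Rightarrow> ('p fm \<Rightarrow> ('w \<times> 'w) set) \<Rightarrow> bool" where
  "N_frame W R \<longleftrightarrow> W \<noteq> {} \<and> (\<forall>B. R B \<subseteq> W \<times> W)"

definition N_model ::
  "'w set \<Rightarrow> ('p fm \<Rightarrow> ('w \<times> 'w) set) \<Rightarrow> ('w \<Rightarrow> 'p fm \<Rightarrow> bool) \<Rightarrow> bool" where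
  "N_model W R sat \<longleftrightarrow> N_frame W R \<and>
     (\<forall>x\<in>W. \<not> sat x Bot \<and>
       (\<forall>B. sat x (Neg B) \<longleftrightarrow> \<not> sat x B) \<and>
       (\<forall>B C. sat x (And B C) \<longleftrightarrow> sat x B \<and> sat x C) \<and>
       (\<forall>B C. sat x (Or B C) \<longleftrightarrow> sat x B \<or> sat x C) \<and>
       (\<forall>B C. sat x (Imp B C) \<longleftrightarrow> (sat x B \<longrightarrow> sat x C)) \<and>
       (\<forall>B. sat x (Box B) \<longleftrightarrow> (\<forall>y\<in>W. (x, y) \<in> R B \<longrightarrow> sat y B)))"

definition valid_in :: "'w set \<Rightarrow> ('p fm \<Rightarrow> ('w \<times> 'w) set) \<Rightarrow> 'p fm \<Rightarrow> bool" where
  "valid_in W R A \<longleftrightarrow> (\<forall>sat. N_model W R sat \<longrightarrow> (\<forall>x\<in>W. sat x A))"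

definition serial_at :: "'w set \<Rightarrow> ('p fm \<Rightarrow> ('w \<times> 'w) set) \<Rightarrow> 'p fm \<Rightarrow> bool" where
  "serial_at W R B \<longleftrightarrow> (\<forall>x\<in>W. \<exists>y\<in>W. (x, y) \<in> R B)"

definition serial_on :: "'p fm set \<Rightarrow> 'w set \<Rightarrow> ('p fm \<Rightarrow> ('w \<times> 'w) set) \<Rightarrow> bool" where
  "serial_on \<Gamma> W R \<longleftrightarrow> (\<forall>B. Box B \<in> \<Gamma> \<longrightarrow> serial_at W R B)"

definition serial :: "'w set \<Rightarrow> ('p fm \<Rightarrow> ('w \<times> 'w) set) \<Rightarrow> bool" where
  "serial W R \<longleftrightarrow> (\<forall>B. serial_at W R B)"

definition transitive_at :: "'w set \<Rightarrow> ('p fm \<Rightarrow> ('w \<times> 'w) set) \<Rightarrow> 'p fm \<Rightarrow> bool" where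
  "transitive_at W R B \<longleftrightarrow>
     (\<forall>x\<in>W. \<forall>y\<in>W. \<forall>z\<in>W. (x, y) \<in> R (Box B) \<longrightarrow> (y, z) \<in> R B \<longrightarrow> (x, z) \<in> R B)"

definition transitive_on :: "'p fm set \<Rightarrow> 'w set \<Rightarrow> ('p fm \<Rightarrow> ('w \<times> 'w) set) \<Rightarrow> bool" where
  "transitive_on \<Gamma> W R \<longleftrightarrow> (\<forall>B. Box (Box B) \<in> \<Gamma> \<longrightarrow> transitive_at W R B)"

definition transitive :: "'w set \<Rightarrow> ('p fm \<Rightarrow> ('w \<times> 'w) set) \<Rightarrow> bool" where
  "transitive W R \<longleftrightarrow> (\<forall>B. transitive_at W R B)"

end

theory Submission
  imports Defs
begin

text \<open>Soundness is an induction on derivations. For completeness, the worlds of a countermodel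
  are the traces on \<open>Sub A\<close> of Boolean valuations satisfying the theorems of \<open>NR4\<close>, with
  \<open>X \<prec>\<^sub>B Y\<close> iff \<open>Box B \<in> X\<close> implies \<open>B \<in> Y\<close>; necessitation gives the truth lemma, the Rosser rule
  seriality, and the axiom 4 transitivity. Conversely a \<open>Sub A\<close>-transitive and \<open>Sub A\<close>-serial frame
  becomes transitive and serial, without affecting \<open>A\<close>, by replacing \<open>\<prec>\<^sub>B\<close> with the identity
  whenever \<open>Box B \<notin> Sub A\<close>: since \<open>Box (Box B) \<in> Sub A\<close> implies \<open>Box B \<in> Sub A\<close>, transitivity at
  \<open>B\<close> is either inherited or has an identity as its first premise.\<close>

section \<open>Subformulas and satisfaction\<close>

lemma finite_Sub: "finite (Sub A)"
  by (induction A) auto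

lemma Sub_refl: "A \<in> Sub A"
  by (cases A) auto

lemma Sub_trans: "B \<in> Sub A \<Longrightarrow> C \<in> Sub B \<Longrightarrow> C \<in> Sub A"
  by (induction A) auto

lemma Sub_subset: "B \<in> Sub A \<Longrightarrow> Sub B \<subseteq> Sub A"
  by (rule subsetI) (rule Sub_trans)

lemma Box_Sub: "Box B \<in> Sub A \<Longrightarrow> B \<in> Sub A"
  using Sub_trans[of "Box B" A B] Sub_refl[of B] by simp

text \<open>\<open>N_model\<close> only constrains a given satisfaction predicate; this recursion
  produces one from the relations and a valuation of the variables.\<close>

primrec holds ::
  "'w set \<Rightarrow> ('p fm \<Rightarrow> ('w \<times> 'w) set) \<Rightarrow> ('w \<Rightarrow> 'p \<Rightarrow> bool) \<Rightarrow> 'p fm \<Rightarrow> 'w \<Rightarrow> bool" where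
  "holds W R V (Var p) x \<longleftrightarrow> V x p"
| "holds W R V Bot x \<longleftrightarrow> False"
| "holds W R V (Neg B) x \<longleftrightarrow> \<not> holds W R V B x"
| "holds W R V (And B C) x \<longleftrightarrow> holds W R V B x \<and> holds W R V C x"
| "holds W R V (Or B C) x \<longleftrightarrow> holds W R V B x \<or> holds W R V C x"
| "holds W R V (Imp B C) x \<longleftrightarrow> (holds W R V B x \<longrightarrow> holds W R V C x)"
| "holds W R V (Box B) x \<longleftrightarrow> (\<forall>y\<in>W. (x, y) \<in> R B \<longrightarrow> holds W R V B y)"

lemma N_model_holds: "N_frame W R \<Longrightarrow> N_model W R (\<lambda>x B. holds W R V B x)"
  by (simp add: N_model_def)

lemma valid_in_imp_holds: "valid_in W R A \<Longrightarrow> N_frame W R \<Longrightarrow> x \<in> W \<Longrightarrow> holds W R V A x"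
  unfolding valid_in_def by (drule spec[of _ "\<lambda>x B. holds W R V B x"]) (simp add: N_model_holds)

lemma N_model_simps:
  assumes "N_model W R sat" "x \<in> W"
  shows "\<not> sat x Bot"
    and "sat x (Neg B) \<longleftrightarrow> \<not> sat x B"
    and "sat x (And B C) \<longleftrightarrow> sat x B \<and> sat x C"
    and "sat x (Or B C) \<longleftrightarrow> sat x B \<or> sat x C"
    and "sat x (Imp B C) \<longleftrightarrow> (sat x B \<longrightarrow> sat x C)"
    and "sat x (Box B) \<longleftrightarrow> (\<forall>y\<in>W. (x, y) \<in> R B \<longrightarrow> sat y B)"
  using assms by (simp_all add: N_model_def)

text \<open>A world is itself a Boolean valuation, with boxed formulas as atoms, so tautologies are
  true in it.\<close>

lemma N_model_prop_eval:
  assumes "N_model W R sat" "x \<in> W"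
  shows "prop_eval (sat x) B \<longleftrightarrow> sat x B"
  by (induction B) (simp_all add: N_model_simps(1-5)[OF assms])

section \<open>Soundness\<close>

lemma NR4_sound:
  assumes "NR4 A" "N_model W R sat" "transitive W R" "serial W R" "x \<in> W"
  shows "sat x A"
  using assms(1,5)
proof (induction arbitrary: x rule: NR4.induct)
  case (Taut A)
  then show ?case
    using N_model_prop_eval[OF assms(2), of x A] by (simp add: tautology_def)
next
  case (Four B)
  have "sat z B" if "sat x (Box B)" "y \<in> W" "(x, y) \<in> R (Box B)" "z \<in> W" "(y, z) \<in> R B" for y z
  proof -
    have "(x, z) \<in> R B"
      using assms(3) Four that unfolding transitive_def transitive_at_def by blast
    then show ?thesis
      using Four that by (simp add: N_model_simps[OF assms(2)])
  qed
  then show ?case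
    using Four by (simp add: N_model_simps[OF assms(2)])
next
  case (MP A B)
  then show ?case
    by (simp add: N_model_simps[OF assms(2)])
next
  case (Nec A)
  then show ?case
    by (simp add: N_model_simps[OF assms(2)])
next
  case (Ros B)
  \<comment> \<open>The induction hypothesis refutes \<open>B\<close> at every world, so a single
    \<open>B\<close>-successor refutes \<open>Box B\<close> at \<open>x\<close>.\<close>
  obtain y where "y \<in> W" "(x, y) \<in> R B"
    using assms(4) Ros.prems by (auto simp: serial_def serial_at_def)
  moreover have "\<not> sat y B"
    using Ros.IH[OF \<open>y \<in> W\<close>] \<open>y \<in> W\<close> by (simp add: N_model_simps[OF assms(2)])
  moreover have "sat x (Box B) \<longleftrightarrow> (\<forall>y\<in>W. (x, y) \<in> R B \<longrightarrow> sat y B)"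
    "sat x (Neg (Box B)) \<longleftrightarrow> \<not> sat x (Box B)"
    using Ros.prems by (simp_all add: N_model_simps[OF assms(2)])
  ultimately show ?case
    by blast
qed

section \<open>From frames restricted to subformulas to full frames\<close>

lemma holds_cong_Sub:
  assumes "N_model W R sat"
    and "\<And>C. Box C \<in> Sub B \<Longrightarrow> R' C = R C"
    and "x \<in> W"
  shows "holds W R' (\<lambda>x p. sat x (Var p)) B x \<longleftrightarrow> sat x B"
  using assms(2,3)
  by (induction B arbitrary: x) (simp_all add: N_model_simps[OF assms(1)])

lemma valid_in_Sub_frame:
  fixes W :: "'w set"
  assumes valid: "\<And>R'. N_frame W R' \<Longrightarrow> transitive W R' \<Longrightarrow> serial W R' \<Longrightarrow> valid_in W R' A"
    and frame: "N_frame W R"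
    and trans: "transitive_on (Sub A) W R"
    and ser: "serial_on (Sub A) W R"
  shows "valid_in W R A"
  unfolding valid_in_def
proof (intro allI impI ballI)
  fix sat x
  assume model: "N_model W R sat" and x: "x \<in> W"
  define R' where "R' B = (if Box B \<in> Sub A then R B else Id_on W)" for B
  have frame': "N_frame W R'"
    using frame by (auto simp: N_frame_def R'_def)
  have "transitive_at W R' B" for B
  proof (cases "Box (Box B) \<in> Sub A")
    case True
    moreover from True have "Box B \<in> Sub A"
      by (rule Box_Sub)
    ultimately show ?thesis
      using trans by (simp add: transitive_on_def transitive_at_def R'_def)
  next
    case False
    then show ?thesis
      by (auto simp: transitive_at_def R'_def)
  qed
  moreover have "serial_at W R' B" for B
    using ser by (auto simp: serial_on_def serial_at_def R'_def)
  ultimately have "valid_in W R' A"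
    using valid frame' by (simp add: transitive_def serial_def)
  \<comment> \<open>Over \<open>R'\<close> the predicate \<open>sat\<close> may fail to be a model.
    Its values on variables are evaluated afresh there, and the result for \<open>A\<close> agrees
    with \<open>sat\<close> because \<open>R'\<close> equals \<open>R\<close> at every
    \<open>C\<close> with \<open>Box C\<close> in \<open>Sub A\<close>.\<close>
  then have "holds W R' (\<lambda>x p. sat x (Var p)) A x"
    using frame' x by (rule valid_in_imp_holds)
  then show "sat x A"
    using holds_cong_Sub[OF model _ x, of A R'] by (simp add: R'_def)
qed

section \<open>Traces of valuations satisfying theorems\<close>

lemma NR4_finite_consequence:
  assumes "finite T" "\<forall>B\<in>T. NR4 B" "\<And>v. \<forall>B\<in>T. prop_eval v B \<Longrightarrow> prop_eval v C"
  shows "NR4 C"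
  using assms
proof (induction T arbitrary: C)
  case empty
  then show ?case
    by (simp add: NR4.Taut tautology_def)
next
  case (insert B T)
  \<comment> \<open>The premise \<open>B\<close> moves into the conclusion, which the induction
    leaves arbitrary; modus ponens then discharges it.\<close>
  have "NR4 (Imp B C)"
    by (rule insert.IH) (use insert.prems in auto)
  then show ?case
    using insert.prems(1) NR4.MP by blast
qed

text \<open>Quantifying over finite sets of theorems, instead of asking for one valuation that satisfies
  all theorems, avoids an appeal to compactness.\<close>

definition realizes :: "'p fm set \<Rightarrow> 'p fm set \<Rightarrow> 'p fm \<Rightarrow> bool" where
  "realizes S X C \<longleftrightarrow> (\<forall>T. finite T \<and> (\<forall>B\<in>T. NR4 B) \<longrightarrow>
     (\<exists>v. (\<forall>B\<in>T. prop_eval v B) \<and> prop_eval v C \<and> X = {B \<in> S. prop_eval v B}))"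

text \<open>Choosing the witness \<open>C\<close> as \<open>B\<close> or as \<open>Neg B\<close> is
  how a trace containing or omitting \<open>B\<close> is obtained.\<close>

definition traces :: "'p fm set \<Rightarrow> 'p fm set set" where
  "traces S = {X. \<exists>C. realizes S X C}"

lemma realizes_valuation:
  assumes "realizes S X C" "NR4 B"
  obtains v where "prop_eval v B" "prop_eval v C" "X = {B \<in> S. prop_eval v B}"
proof -
  have "\<exists>v. (\<forall>D\<in>{B}. prop_eval v D) \<and> prop_eval v C \<and> X = {D \<in> S. prop_eval v D}"
    using assms(1)[unfolded realizes_def, rule_format, of "{B}"] assms(2) by simp
  then obtain v where "prop_eval v B" "prop_eval v C" "X = {D \<in> S. prop_eval v D}"
    by auto
  then show thesis
    by (rule that)
qed

lemma traces_valuation: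
  assumes "X \<in> traces S" "NR4 B"
  obtains v where "prop_eval v B" "X = {B \<in> S. prop_eval v B}"
proof -
  obtain C where "realizes S X C"
    using assms(1) by (auto simp: traces_def)
  then obtain v where "prop_eval v B" "X = {B \<in> S. prop_eval v B}"
    using assms(2) by (rule realizes_valuation)
  then show thesis
    by (rule that)
qed

text \<open>A theorem to supply where only the existence of a valuation with the given trace
  matters.\<close>

lemma NR4_Imp_Bot_Bot: "NR4 (Imp Bot Bot)"
  by (rule NR4.Taut) (simp add: tautology_def)

lemma traces_subset: "traces S \<subseteq> Pow S"
proof
  fix X
  assume "X \<in> traces S"
  then obtain v where "X = {B \<in> S. prop_eval v B}"
    using NR4_Imp_Bot_Bot by (rule traces_valuation)
  then show "X \<in> Pow S"
    by blast
qed

text \<open>Otherwise each of the finitely many candidates \<open>X\<close> is excluded by its own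
  finite set \<open>T X\<close> of theorems. Every valuation has some candidate as its trace, so the
  finite union of these sets entails \<open>Neg C\<close>.\<close>

lemma realizes_exists:
  assumes "finite S" "\<not> NR4 (Neg C)"
  shows "\<exists>X. realizes S X C"
proof (rule ccontr)
  assume "\<nexists>X. realizes S X C"
  then have "\<forall>X. \<exists>T. (finite T \<and> (\<forall>B\<in>T. NR4 B)) \<and>
      \<not> (\<exists>v. (\<forall>B\<in>T. prop_eval v B) \<and> prop_eval v C \<and> X = {B \<in> S. prop_eval v B})"
    by (simp only: realizes_def not_ex not_all not_imp simp_thms)
  from choice[OF this] obtain T where T: "\<forall>X. (finite (T X) \<and> (\<forall>B\<in>T X. NR4 B)) \<and>
      \<not> (\<exists>v. (\<forall>B\<in>T X. prop_eval v B) \<and> prop_eval v C \<and> X = {B \<in> S. prop_eval v B})"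
    by (rule exE)
  have "NR4 (Neg C)"
  proof (rule NR4_finite_consequence)
    show "finite (\<Union>X\<in>Pow S. T X)"
      using assms(1) T by simp
    show "\<forall>B\<in>\<Union>X\<in>Pow S. T X. NR4 B"
      using T by simp
    fix v
    assume v: "\<forall>B\<in>\<Union>X\<in>Pow S. T X. prop_eval v B"
    \<comment> \<open>The candidate to use is the trace of \<open>v\<close> itself: \<open>v\<close>
      satisfies \<open>T X\<close>, so it cannot satisfy \<open>C\<close>.\<close>
    define X where "X = {B \<in> S. prop_eval v B}"
    then have "X \<in> Pow S"
      by simp
    then have "\<forall>B\<in>T X. prop_eval v B"
      using v by simp
    then show "prop_eval v (Neg C)"
      using conjunct2[OF spec[OF T, of X]] X_def by auto
  qed
  with assms(2) show False ..
qed

lemma traces_member: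
  assumes "finite S" "B \<in> S" "\<not> NR4 (Neg B)"
  shows "\<exists>X\<in>traces S. B \<in> X"
proof -
  obtain X where X: "realizes S X B"
    using realizes_exists assms(1,3) by blast
  then obtain v where "prop_eval v B" "X = {B \<in> S. prop_eval v B}"
    using NR4_Imp_Bot_Bot by (rule realizes_valuation)
  then have "B \<in> X"
    using assms(2) by simp
  with X show ?thesis
    by (auto simp: traces_def)
qed

text \<open>The formula to realize is \<open>Neg B\<close>, which may lie outside \<open>S\<close>;
  hence the separate argument \<open>C\<close> of \<open>realizes\<close>.\<close>

lemma traces_nonmember:
  assumes "finite S" "\<not> NR4 B"
  shows "\<exists>X\<in>traces S. B \<notin> X"
proof -
  have "\<not> NR4 (Neg (Neg B))"
  proof
    assume "NR4 (Neg (Neg B))"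
    then have "NR4 B"
      by (intro NR4_finite_consequence[of "{Neg (Neg B)}"]) auto
    with assms(2) show False ..
  qed
  then obtain X where X: "realizes S X (Neg B)"
    using realizes_exists assms(1) by blast
  then obtain v where "prop_eval v (Neg B)" "X = {B \<in> S. prop_eval v B}"
    using NR4_Imp_Bot_Bot by (rule realizes_valuation)
  then have "B \<notin> X"
    by simp
  with X show ?thesis
    by (auto simp: traces_def)
qed

lemma NR4_in_trace: "X \<in> traces S \<Longrightarrow> NR4 B \<Longrightarrow> B \<in> S \<Longrightarrow> B \<in> X"
  by (erule (1) traces_valuation) simp

lemma NR4_Neg_notin_trace: "X \<in> traces S \<Longrightarrow> NR4 (Neg B) \<Longrightarrow> B \<notin> X"
  by (erule (1) traces_valuation) simp

lemma trace_Box_Box: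
  assumes "X \<in> traces S" "Box B \<in> X" "Box (Box B) \<in> S"
  shows "Box (Box B) \<in> X"
proof -
  obtain v where "prop_eval v (Imp (Box B) (Box (Box B)))" "X = {B \<in> S. prop_eval v B}"
    using assms(1) NR4.Four by (rule traces_valuation)
  then show ?thesis
    using assms(2,3) by simp
qed

lemma trace_connectives:
  assumes "X \<in> traces S"
  shows "Bot \<notin> X"
    and "Neg B \<in> S \<Longrightarrow> B \<in> S \<Longrightarrow> Neg B \<in> X \<longleftrightarrow> B \<notin> X"
    and "And B C \<in> S \<Longrightarrow> B \<in> S \<Longrightarrow> C \<in> S \<Longrightarrow> And B C \<in> X \<longleftrightarrow> B \<in> X \<and> C \<in> X"
    and "Or B C \<in> S \<Longrightarrow> B \<in> S \<Longrightarrow> C \<in> S \<Longrightarrow> Or B C \<in> X \<longleftrightarrow> B \<in> X \<or> C \<in> X"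
    and "Imp B C \<in> S \<Longrightarrow> B \<in> S \<Longrightarrow> C \<in> S \<Longrightarrow> Imp B C \<in> X \<longleftrightarrow> (B \<in> X \<longrightarrow> C \<in> X)"
proof -
  obtain v where "X = {B \<in> S. prop_eval v B}"
    using assms NR4_Imp_Bot_Bot by (rule traces_valuation)
  then show "Bot \<notin> X"
    and "Neg B \<in> S \<Longrightarrow> B \<in> S \<Longrightarrow> Neg B \<in> X \<longleftrightarrow> B \<notin> X"
    and "And B C \<in> S \<Longrightarrow> B \<in> S \<Longrightarrow> C \<in> S \<Longrightarrow> And B C \<in> X \<longleftrightarrow> B \<in> X \<and> C \<in> X"
    and "Or B C \<in> S \<Longrightarrow> B \<in> S \<Longrightarrow> C \<in> S \<Longrightarrow> Or B C \<in> X \<longleftrightarrow> B \<in> X \<or> C \<in> X"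
    and "Imp B C \<in> S \<Longrightarrow> B \<in> S \<Longrightarrow> C \<in> S \<Longrightarrow> Imp B C \<in> X \<longleftrightarrow> (B \<in> X \<longrightarrow> C \<in> X)"
    by auto
qed

section \<open>The finite countermodel\<close>

definition trace_rel ::
  "'w set \<Rightarrow> ('w \<Rightarrow> 'p fm set) \<Rightarrow> 'p fm \<Rightarrow> ('w \<times> 'w) set" where
  "trace_rel W g B = {(x, y). x \<in> W \<and> y \<in> W \<and> (Box B \<in> g x \<longrightarrow> B \<in> g y)}"

text \<open>Along \<open>x\<close>, \<open>y\<close>, \<open>z\<close>, axiom 4 takes
  \<open>Box B\<close> in \<open>g x\<close> to \<open>Box (Box B)\<close> in \<open>g x\<close>;
  the two relations then give \<open>Box B\<close> in \<open>g y\<close> and \<open>B\<close> in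
  \<open>g z\<close>.\<close>

lemma transitive_on_trace_rel:
  assumes "g ` W = traces S"
  shows "transitive_on S W (trace_rel W g)"
proof -
  have "Box (Box B) \<in> g x" if "x \<in> W" "Box B \<in> g x" "Box (Box B) \<in> S" for x B
    using trace_Box_Box that assms by (metis imageI)
  then show ?thesis
    by (simp add: transitive_on_def transitive_at_def trace_rel_def)
qed

lemma serial_on_trace_rel:
  assumes "g ` W = traces (Sub A)"
  shows "serial_on (Sub A) W (trace_rel W g)"
  unfolding serial_on_def serial_at_def
proof (intro allI impI ballI)
  fix B x
  assume B: "Box B \<in> Sub A" and x: "x \<in> W"
  then have gx: "g x \<in> traces (Sub A)"
    using assms by blast
  show "\<exists>y\<in>W. (x, y) \<in> trace_rel W g B"
  proof (cases "Box B \<in> g x")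
    case True
    \<comment> \<open>Were \<open>Neg B\<close> a theorem, \<open>Neg (Box B)\<close> would be one
      too, and no trace could contain \<open>Box B\<close>.\<close>
    then have "\<not> NR4 (Neg B)"
      using gx NR4_Neg_notin_trace NR4.Ros by blast
    then obtain X where "X \<in> traces (Sub A)" "B \<in> X"
      using traces_member[OF finite_Sub Box_Sub[OF B]] by blast
    then obtain y where "y \<in> W" "B \<in> g y"
      using assms by (metis imageE)
    then show ?thesis
      using x by (auto simp: trace_rel_def)
  next
    case False
    \<comment> \<open>Now every world is a \<open>B\<close>-successor of \<open>x\<close>, including
      \<open>x\<close> itself.\<close>
    then show ?thesis
      using x by (auto simp: trace_rel_def)
  qed
qed

lemma trace_truth:
  assumes "g ` W = traces (Sub A)" "B \<in> Sub A" "x \<in> W"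
  shows "holds W (trace_rel W g) (\<lambda>x p. Var p \<in> g x) B x \<longleftrightarrow> B \<in> g x"
  using assms(2,3)
proof (induction B arbitrary: x)
  case (Box B)
  have B: "B \<in> Sub A"
    using Box.prems(1) by (rule Box_Sub)
  \<comment> \<open>When \<open>Box B\<close> is not in \<open>g x\<close>, all worlds are
    \<open>B\<close>-successors of \<open>x\<close>, so any trace omitting \<open>B\<close> refutes
    \<open>Box B\<close>. One exists, since otherwise \<open>B\<close> would be a theorem and
    necessitation would put \<open>Box B\<close> into \<open>g x\<close>.\<close>
  have "\<exists>y\<in>W. B \<notin> g y" if "Box B \<notin> g x"
  proof -
    have "g x \<in> traces (Sub A)"
      using assms(1) Box.prems(2) by blast
    then have "\<not> NR4 B"
      using that NR4_in_trace Box.prems(1) NR4.Nec by blast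
    then obtain X where "X \<in> traces (Sub A)" "B \<notin> X"
      using traces_nonmember[OF finite_Sub] by blast
    then show ?thesis
      using assms(1) by (metis imageE)
  qed
  then show ?case
    using Box.IH[OF B] Box.prems(2) by (auto simp: trace_rel_def)
next
  case (Neg B)
  have "B \<in> Sub A" "g x \<in> traces (Sub A)"
    using Neg.prems Sub_subset[OF Neg.prems(1)] Sub_refl[of B] assms(1) by auto
  then show ?case
    using Neg by (simp add: trace_connectives(2))
next
  case (And B C)
  have "B \<in> Sub A" "C \<in> Sub A" "g x \<in> traces (Sub A)"
    using And.prems Sub_subset[OF And.prems(1)] Sub_refl[of B] Sub_refl[of C] assms(1) by auto
  then show ?case
    using And by (simp add: trace_connectives(3))
next
  case (Or B C)
  have "B \<in> Sub A" "C \<in> Sub A" "g x \<in> traces (Sub A)"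
    using Or.prems Sub_subset[OF Or.prems(1)] Sub_refl[of B] Sub_refl[of C] assms(1) by auto
  then show ?case
    using Or by (simp add: trace_connectives(4))
next
  case (Imp B C)
  have "B \<in> Sub A" "C \<in> Sub A" "g x \<in> traces (Sub A)"
    using Imp.prems Sub_subset[OF Imp.prems(1)] Sub_refl[of B] Sub_refl[of C] assms(1) by auto
  then show ?case
    using Imp by (simp add: trace_connectives(5))
next
  case Bot
  then show ?case
    using assms(1) trace_connectives(1) by auto
qed simp

lemma NR4_complete:
  fixes A :: "'p fm"
  assumes inf: "infinite (UNIV :: 'w set)"
    and valid: "\<And>(W :: 'w set) R. N_frame W R \<Longrightarrow> finite W \<Longrightarrow> transitive_on (Sub A) W R \<Longrightarrow>
      serial_on (Sub A) W R \<Longrightarrow> valid_in W R A"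
  shows "NR4 A"
proof (rule ccontr)
  assume "\<not> NR4 A"
  then obtain X where X: "X \<in> traces (Sub A)" "A \<notin> X"
    using traces_nonmember[OF finite_Sub] by blast
  have fin: "finite (traces (Sub A))"
    using traces_subset finite_Sub by (metis finite_Pow_iff finite_subset)
  \<comment> \<open>Traces are not elements of \<open>'w\<close>. A subset of \<open>'w\<close> of
    the same size serves as the set of worlds, and the bijection \<open>g\<close> labels them with
    traces.\<close>
  obtain W :: "'w set" where W: "finite W" "card W = card (traces (Sub A))"
    using infinite_arbitrarily_large[OF inf] by blast
  then obtain g where "bij_betw g W (traces (Sub A))"
    using finite_same_card_bij fin by blast
  then have g: "g ` W = traces (Sub A)"
    by (rule bij_betw_imp_surj_on)
  then obtain x where x: "x \<in> W" "g x = X"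
    using X(1) by (metis imageE)
  have frame: "N_frame W (trace_rel W g)"
    using x(1) by (auto simp: N_frame_def trace_rel_def)
  then have "valid_in W (trace_rel W g) A"
    using W(1) transitive_on_trace_rel[OF g] serial_on_trace_rel[OF g] by (rule valid)
  then have "holds W (trace_rel W g) (\<lambda>x p. Var p \<in> g x) A x"
    using frame x(1) by (rule valid_in_imp_holds)
  then have "A \<in> g x"
    by (simp add: trace_truth[OF g Sub_refl x(1)])
  with X(2) x(2) show False
    by simp
qed

(* HOL formulas cannot quantify over types, so "all frames" means all frames whose set of worlds
   is a subset of an arbitrary infinite type 'w. Every finite frame is isomorphic to one of these,
   and every frame of any cardinality is covered by a suitable instance of 'w. *)
theorem theorem3p14:
  fixes A :: "'p fm"
  assumes "infinite (UNIV :: 'w set)"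
  defines "P1 \<equiv> NR4 A"
    and "P2 \<equiv> \<forall>(W :: 'w set) R. N_frame W R \<and> transitive W R \<and> serial W R
           \<longrightarrow> valid_in W R A"
    and "P3 \<equiv> \<forall>(W :: 'w set) R. N_frame W R \<and> finite W \<and> transitive W R \<and> serial W R
           \<longrightarrow> valid_in W R A"
    and "P4 \<equiv> \<forall>(W :: 'w set) R. N_frame W R \<and> finite W \<and>
           transitive_on (Sub A) W R \<and> serial_on (Sub A) W R \<longrightarrow> valid_in W R A"
  shows "(P1 \<longleftrightarrow> P2) \<and> (P2 \<longleftrightarrow> P3) \<and> (P3 \<longleftrightarrow> P4)"
proof -
  have "P1 \<Longrightarrow> P2"
    unfolding P1_def P2_def valid_in_def by (auto intro: NR4_sound)
  moreover have "P2 \<Longrightarrow> P3"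
    unfolding P2_def P3_def by blast
  moreover have "P3 \<Longrightarrow> P4"
    unfolding P3_def P4_def by (intro allI impI, rule valid_in_Sub_frame) auto
  moreover have "P4 \<Longrightarrow> P1"
    unfolding P4_def P1_def by (rule NR4_complete[OF assms(1)]) blast
  ultimately show ?thesis
    by blast
qed

end
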